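(* Let $A:\mathbb{R}^p\to\mathbb{R}^d$ be linear, let $J:\mathbb{R}^p\to\mathbb{R}\cup\{+\infty\}$ be proper, convex and lower semicontinuous, and let $f\in\mathbb{R}^d$. Let $(\bar x,\bar y)\in\mathbb{R}^p\times\mathbb{R}^d$ satisfy $-A^*\bar y\in\partial J(\bar x)$ and $A\bar x=f$. Let $\delta>0$ and let $f^\delta\in\mathbb{R}^d$ satisfy $\|f^\delta-f\|\le\delta$. Assume that for every $y\in\mathbb{R}^d$ the chain rule $\partial\left[J^\star(-A^*\cdot)\right](y)=-A\,\partial J^\star(-A^*y)$ holds. Let $(x(t),y(t))_{t\ge 0}$ be a solution of the dual subgradient flow $$x(t)\in\partial J^\star(-A^*y(t)),\qquad \dot y(t)=Ax(t)-f^\delta ,$$ with $y(0)\neq\bar y$, and for $t>0$ set $\hat x(t):=\frac{2}{t}\int_{t/2}^{t}x(s)\,ds$. Then, for $t^*:=\frac1\delta\|y(0)-\bar y\|$, $$D^{-A^*\bar y}(\hat x(t^* ),\bar x)\le 4\|y(0)-\bar y\|\,\delta\qquad\text{and}\qquad \|A\hat x(t^* )-f\|\le\sqrt{14}\,\delta.$$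
   Context: Norms and inner products are Euclidean; $A^*$ is the adjoint of $A$; $J^\star(x):=\sup_{z\in\mathbb{R}^p}\langle x,z\rangle-J(z)$ is the Fenchel conjugate; $\partial$ denotes the convex subdifferential. For $u\in\partial J(x_2)$, the Bregman divergence is $D^{u}(x_1,x_2):=J(x_1)-J(x_2)-\langle u,x_1-x_2\rangle$. A solution of the dual subgradient flow is a pair $x:[0,\infty)\to\mathbb{R}^p$, $y:[0,\infty)\to\mathbb{R}^d$ such that: $y$ is Lipschitz continuous on $[0,\infty)$; $x(t)\in\partial J^\star(-A^*y(t))$ for all $t\ge0$ (in particular the function $\mathcal{D}_\delta(y):=J^\star(-A^*y)+\langle f^\delta,y\rangle$ has nonempty subdifferential at $y(t)$ for all $t\ge 0$, including the initial point $y(0)$); $\dot y(t)=Ax(t)-f^\delta$ for almost every $t\ge0$; and $x$ is measurable and integrable on bounded intervals, so that $\hat x(t)$ is defined. *)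

theory Defs
  imports "HOL-Analysis.Analysis"
begin

text \<open>Functions with values in $\mathbb{R}\cup\{+\infty\}$ are rendered as functions into
  \<^typ>\<open>ereal\<close>; the value \<open>-\<infinity>\<close> is excluded by properness.\<close>

definition proper_fun :: "('a \<Rightarrow> ereal) \<Rightarrow> bool" where
  "proper_fun J \<longleftrightarrow> (\<forall>x. J x \<noteq> -\<infinity>) \<and> (\<exists>x. J x \<noteq> \<infinity>)"

text \<open>In \<^typ>\<open>ereal\<close>, \<open>0 * \<infinity> = 0\<close>, so the endpoints \<open>t = 0\<close> and \<open>t = 1\<close> impose no condition.\<close>

definition convex_fun :: "('a::real_vector \<Rightarrow> ereal) \<Rightarrow> bool" where
  "convex_fun J \<longleftrightarrow>
     (\<forall>x y t. 0 \<le> t \<and> t \<le> 1 \<longrightarrow>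
        J ((1 - t) *\<^sub>R x + t *\<^sub>R y) \<le> ereal (1 - t) * J x + ereal t * J y)"

definition lsc_fun :: "('a::topological_space \<Rightarrow> ereal) \<Rightarrow> bool" where
  "lsc_fun J \<longleftrightarrow> (\<forall>x. J x \<le> Liminf (at x) J)"

definition fenchel_conj :: "('a::real_inner \<Rightarrow> ereal) \<Rightarrow> 'a \<Rightarrow> ereal" where
  "fenchel_conj J x = (SUP z. ereal (x \<bullet> z) - J z)"

text \<open>As usual, the subdifferential is empty at points where the function is not finite.\<close>

definition subdifferential :: "('a::real_inner \<Rightarrow> ereal) \<Rightarrow> 'a \<Rightarrow> 'a set" where
  "subdifferential J x =
     {u. \<bar>J x\<bar> \<noteq> \<infinity> \<and> (\<forall>z. J x + ereal (u \<bullet> (z - x)) \<le> J z)}"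

text \<open>Meaningful only for \<open>u \<in> subdifferential J x2\<close>, so that \<open>J x2\<close> is finite.\<close>

definition bregman :: "('a::real_inner \<Rightarrow> ereal) \<Rightarrow> 'a \<Rightarrow> 'a \<Rightarrow> 'a \<Rightarrow> ereal" where
  "bregman J u x1 x2 = J x1 - J x2 - ereal (u \<bullet> (x1 - x2))"

text \<open>Trajectories are total functions on \<^typ>\<open>real\<close>; their values at negative times are irrelevant.\<close>

definition dual_subgradient_flow ::
  "('a::euclidean_space \<Rightarrow> ereal) \<Rightarrow> ('a \<Rightarrow> 'b::euclidean_space) \<Rightarrow> 'b \<Rightarrow>
     (real \<Rightarrow> 'a) \<Rightarrow> (real \<Rightarrow> 'b) \<Rightarrow> bool" where
  "dual_subgradient_flow J A g x y \<longleftrightarrow>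
     (\<exists>L. L-lipschitz_on {0..} y) \<and>
     (\<forall>t\<ge>0. x t \<in> subdifferential (fenchel_conj J) (- adjoint A (y t))) \<and>
     (AE t in lebesgue. 0 \<le> t \<longrightarrow>
        (y has_vector_derivative (A (x t) - g)) (at t within {0..})) \<and>
     x \<in> borel_measurable (lebesgue_on {0..}) \<and>
     (\<forall>a b. 0 \<le> a \<and> a \<le> b \<longrightarrow> set_integrable lebesgue {a..b} x)"

definition tail_average :: "(real \<Rightarrow> 'a::euclidean_space) \<Rightarrow> real \<Rightarrow> 'a" where
  "tail_average x t = (2 / t) *\<^sub>R (LINT s:{t/2..t}|lebesgue. x s)"

end

(* The dual variable y follows the gradient flow of the convex functional
   D(y) = J*(-A* y) + <f\<delta>, y>.  Its excess \<phi> = D(y) - D(ybar) dissipates at rate |v|^2, where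
   v = dy/dt = A x - f\<delta>.  As f and f\<delta> differ by at most \<delta>, the excess is at least
   -\<delta> |y - ybar|, and |y - ybar| grows at rate at most \<delta>; so it stays below 2r, with
   r = |y(0) - ybar|, up to time t = r/\<delta>.  Integrating d/ds |y - ybar|^2/2 \<le> -\<phi> gives
   \<phi>(t/2) \<le> r^2/t = r\<delta>, and dissipation on [t/2, t] with Cauchy-Schwarz gives
   |A xhat - f\<delta>|^2 \<le> (2/t) (r\<delta> + 2r\<delta>) = 6 \<delta>^2, where 1 + sqrt 6 < sqrt 14.
   For the Bregman distance, J equals its biconjugate, so it suffices to average over [t/2, t] the
   subgradient inequality of J* along the flow, tested with an arbitrary affine minorant of J;
   this yields (2/t) (7/8 + 9/8) r^2 = 4 r\<delta>. *)

theory Submission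
  imports Defs
begin

subsection \<open>Convex functionals along Lipschitz curves\<close>

text \<open>With an antiderivative \<open>U\<close> of \<open>u\<close>, the integral of the scaled
  backward difference collapses to the difference of the backward quotients of \<open>U\<close> at
  \<open>b\<close> and at \<open>a\<close>, and these converge to \<open>u b\<close> and
  \<open>u a\<close>.\<close>

lemma backward_difference_quotient_integral:
  fixes u :: "real \<Rightarrow> real"
  assumes cont: "continuous_on UNIV u" and "a \<le> b"
  shows "(\<lambda>n. integral {a..b} (\<lambda>s. real (Suc n) * (u s - u (s - inverse (real (Suc n))))))
           \<longlonglongrightarrow> u b - u a"
proof -
  \<comment> \<open>Shifts have length at most 1; the margin of 2 makes \<open>U\<close>
    differentiable from both sides at every shifted point.\<close>
  obtain U where U: "\<And>x. x \<in> {a-2..b+2} \<Longrightarrow> (U has_vector_derivative u x) (at x within {a-2..b+2})"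
    using antiderivative_continuous[OF continuous_on_subset[OF cont subset_UNIV]] by blast
  have dU: "(U has_vector_derivative u x) (at x)" if "a - 1 \<le> x" "x \<le> b + 1" for x
    using U[of x] that by (simp add: at_within_Icc_at)
  define h where "h n = inverse (real (Suc n))" for n
  have h: "0 < h n" "h n \<le> 1" "real (Suc n) = inverse (h n)" for n
    by (auto simp: h_def field_simps)
  have h0: "h \<longlonglongrightarrow> 0"
    unfolding h_def by (rule LIMSEQ_inverse_real_of_nat)
  have I: "((\<lambda>s. u (s - c)) has_integral (U (b - c) - U (a - c))) {a..b}"
    if "0 \<le> c" "c \<le> 1" for c
  proof (rule fundamental_theorem_of_calculus[OF \<open>a \<le> b\<close>])
    fix s assume s: "s \<in> {a..b}"
    have "((\<lambda>s. s - c) has_vector_derivative 1) (at s within {a..b})"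
      by (auto intro!: derivative_eq_intros)
    moreover have "(U has_vector_derivative u (s - c)) (at (s - c) within (\<lambda>s. s - c) ` {a..b})"
      using s that by (auto intro: has_vector_derivative_at_within[OF dU])
    ultimately show "((\<lambda>s. U (s - c)) has_vector_derivative u (s - c)) (at s within {a..b})"
      using vector_diff_chain_within[of "\<lambda>s. s - c" 1 s "{a..b}" U "u (s - c)"]
      by (simp add: o_def)
  qed
  have eq: "integral {a..b} (\<lambda>s. real (Suc n) * (u s - u (s - inverse (real (Suc n)))))
          = (U (b - h n) - U b) / (- h n) - (U (a - h n) - U a) / (- h n)" for n
  proof -
    have "((\<lambda>s. u (s - 0) - u (s - h n)) has_integral
            ((U (b - 0) - U (a - 0)) - (U (b - h n) - U (a - h n)))) {a..b}"
      by (intro has_integral_diff I) (use h(1,2)[of n] in auto)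
    from integral_unique[OF has_integral_mult_right[OF this, of "inverse (h n)"]]
    have int: "integral {a..b} (\<lambda>s. inverse (h n) * (u s - u (s - h n)))
        = inverse (h n) * (U b - U a - (U (b - h n) - U (a - h n)))"
      by (simp only: diff_zero)
    show ?thesis
      unfolding h(3) inverse_inverse_eq int by (simp add: divide_inverse algebra_simps)
  qed
  have lim: "(\<lambda>n. (U (x - h n) - U x) / (- h n)) \<longlonglongrightarrow> u x" if "a \<le> x" "x \<le> b" for x
  proof -
    have 1: "((\<lambda>k. (U (x + k) - U x) / k) \<longlongrightarrow> u x) (at 0)"
      using dU[of x] that
      by (simp add: has_real_derivative_iff_has_vector_derivative[symmetric] DERIV_def)
    have 2: "filterlim (\<lambda>n. - h n) (at 0) sequentially"
      unfolding filterlim_at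
    proof
      show "\<forall>\<^sub>F n in sequentially. - h n \<in> UNIV \<and> - h n \<noteq> 0"
        using h(1) by (intro always_eventually allI) (simp add: less_imp_neq[symmetric])
    qed (use tendsto_minus[OF h0] in simp)
    show ?thesis
      using filterlim_compose[OF 1 2] by simp
  qed
  show ?thesis
    unfolding eq using \<open>a \<le> b\<close> by (intro tendsto_diff lim) auto
qed

text \<open>Backward difference quotients of \<open>Y\<close> converge to \<open>v\<close> almost everywhere and are bounded by
  \<open>L\<close>, so dominated convergence applies although \<open>\<Phi>\<close> itself is not known to be differentiable.\<close>

lemma subgradient_along_curve_integral:
  fixes Y :: "real \<Rightarrow> 'a::euclidean_space" and \<Phi> :: "real \<Rightarrow> real"
  assumes ab: "a < b"
    and lip: "L-lipschitz_on {a..b} Y"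
    and cont: "continuous_on {a..b} \<Phi>"
    and deriv: "AE s in lebesgue_on {a..b}. (Y has_vector_derivative v s) (at s within {a..b})"
    and pm: "p \<in> borel_measurable (lebesgue_on {a..b})"
    and vm: "v \<in> borel_measurable (lebesgue_on {a..b})"
    and pK: "AE s in lebesgue_on {a..b}. norm (p s) \<le> K"
    and sub: "AE s in lebesgue_on {a..b}. \<forall>s'\<in>{a..b}.
                \<Phi> s + p s \<bullet> (Y s' - Y s) - C * (s' - s)\<^sup>2 \<le> \<Phi> s'"
  shows "integrable (lebesgue_on {a..b}) (\<lambda>s. p s \<bullet> v s)"
    and "\<Phi> b - \<Phi> a \<le> integral\<^sup>L (lebesgue_on {a..b}) (\<lambda>s. p s \<bullet> v s)"
proof -
  let ?M = "lebesgue_on {a..b}"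
  \<comment> \<open>Clamping to the interval extends \<open>Y\<close> and \<open>\<Phi>\<close> by
    constants, so backward shifts past \<open>a\<close> are harmless and no Lipschitz or continuity
    bound gets worse.\<close>
  define c where "c s = max a (min b s)" for s
  have c: "c s \<in> {a..b}" for s using ab by (auto simp: c_def)
  have c_id: "c s = s" if "s \<in> {a..b}" for s using that by (auto simp: c_def)
  have c_cont: "continuous_on S c" for S unfolding c_def by (intro continuous_intros)
  have c_dist: "\<bar>c s - c s'\<bar> \<le> \<bar>s - s'\<bar>" for s s' by (auto simp: c_def)
  define h where "h n = inverse (real (Suc n))" for n
  have h: "0 < h n" "h n \<le> 1" "real (Suc n) = inverse (h n)" for n
    by (auto simp: h_def field_simps)
  have h0: "h \<longlonglongrightarrow> 0"
    unfolding h_def by (rule LIMSEQ_inverse_real_of_nat)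
  have L0: "0 \<le> L" using lip by (rule lipschitz_on_nonneg)
  have Ycont: "continuous_on {a..b} Y" using lip by (rule lipschitz_on_continuous_on)
  have Yc: "continuous_on S (\<lambda>s. Y (c (s - k)))" for S k
    by (rule continuous_on_compose2[OF Ycont]) (use c in \<open>auto intro!: continuous_intros continuous_on_compose2[OF c_cont]\<close>)
  have \<Phi>c: "continuous_on S (\<lambda>s. \<Phi> (c (s - k)))" for S k
    by (rule continuous_on_compose2[OF cont]) (use c in \<open>auto intro!: continuous_intros continuous_on_compose2[OF c_cont]\<close>)
  define q where "q n s = inverse (h n) *\<^sub>R (Y (c s) - Y (c (s - h n)))" for n s
  \<comment> \<open>The quadratic error, divided by the step \<open>h n\<close>, is at most
    \<open>\<bar>C\<bar> * h n\<close>; adding it makes \<open>w n\<close> dominate the difference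
    quotient of \<open>\<Phi>\<close> and leaves the limit unchanged.\<close>
  define w where "w n s = p s \<bullet> q n s + \<bar>C\<bar> * h n" for n s
  have q_bound: "norm (q n s) \<le> L" for n s
  proof -
    have "norm (Y (c s) - Y (c (s - h n))) \<le> L * h n"
    proof -
      have "norm (Y (c s) - Y (c (s - h n))) \<le> L * \<bar>c s - c (s - h n)\<bar>"
        using lipschitz_onD[OF lip c c] by (simp add: dist_norm)
      also have "\<dots> \<le> L * h n"
        using c_dist[of s "s - h n"] h(1)[of n] L0 by (intro mult_left_mono) auto
      finally show ?thesis .
    qed
    then show ?thesis using h(1)[of n] by (simp add: q_def divide_simps mult.commute)
  qed
  have q_meas: "q n \<in> borel_measurable ?M" for n
    unfolding q_def using Yc[of _ 0] Yc[of _ "h n"]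
    by (intro continuous_imp_measurable_on_sets_lebesgue continuous_intros) auto
  have wm: "w n \<in> borel_measurable ?M" for n
    unfolding w_def using pm q_meas by measurable
  have pvm: "(\<lambda>s. p s \<bullet> v s) \<in> borel_measurable ?M"
    using pm vm by measurable
  have const: "integrable ?M (\<lambda>s. \<bar>K\<bar> * L + \<bar>C\<bar>)"
    by (intro continuous_imp_integrable_real continuous_intros)
  have bound: "AE s in ?M. norm (w n s) \<le> \<bar>K\<bar> * L + \<bar>C\<bar>" for n
    using pK
  proof eventually_elim
    case (elim s)
    have "\<bar>p s \<bullet> q n s\<bar> \<le> norm (p s) * norm (q n s)" by (rule Cauchy_Schwarz_ineq2)
    also have "\<dots> \<le> \<bar>K\<bar> * L" using elim q_bound[of n s] by (intro mult_mono) auto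
    finally have "\<bar>p s \<bullet> q n s\<bar> \<le> \<bar>K\<bar> * L" .
    moreover have "0 \<le> \<bar>C\<bar> * h n" "\<bar>C\<bar> * h n \<le> \<bar>C\<bar>" using h(1,2)[of n]
      by (auto intro: mult_left_le)
    ultimately show ?case unfolding w_def real_norm_def by linarith
  qed
  \<comment> \<open>At \<open>s = a\<close> the clamped backward shift does not move, so
    \<open>q n a = 0\<close> says nothing about \<open>v a\<close>; this single point is
    discarded.\<close>
  have "AE s in lebesgue. s \<noteq> a"
    by (rule AE_I'[of "{a}"]) auto
  then have nea: "AE s in ?M. a < s"
    by (auto simp: AE_restrict_space_iff)
  have conv: "AE s in ?M. (\<lambda>n. w n s) \<longlonglongrightarrow> p s \<bullet> v s"
    using deriv nea AE_space
  proof eventually_elim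
    case (elim s)
    then have s: "s \<in> {a..b}" "a < s" by auto
    have "((\<lambda>z. norm (Y z - Y s - (z - s) *\<^sub>R v s) / norm (z - s)) \<longlongrightarrow> 0) (at s within {a..b})"
      using elim(1) unfolding has_vector_derivative_def has_derivative_iff_norm by blast
    moreover have "norm (Y z - Y s - (z - s) *\<^sub>R v s) / norm (z - s)
        = norm ((1 / (z - s)) *\<^sub>R (Y z - Y s) - v s)" if "z \<noteq> s" for z
    proof -
      have "(1 / (z - s)) *\<^sub>R (Y z - Y s) - v s = (1 / (z - s)) *\<^sub>R (Y z - Y s - (z - s) *\<^sub>R v s)"
        using that by (simp add: scaleR_diff_right)
      then show ?thesis by simp
    qed
    ultimately have "((\<lambda>z. norm ((1 / (z - s)) *\<^sub>R (Y z - Y s) - v s)) \<longlongrightarrow> 0) (at s within {a..b})"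
      by (elim Lim_transform_eventually) (simp add: eventually_at_filter)
    then have 1: "((\<lambda>z. (1 / (z - s)) *\<^sub>R (Y z - Y s)) \<longlongrightarrow> v s) (at s within {a..b})"
      by (simp add: tendsto_norm_zero_iff LIM_zero_cancel)
    have ev: "\<forall>\<^sub>F n in sequentially. c (s - h n) = s - h n"
    proof -
      have "\<forall>\<^sub>F n in sequentially. h n < s - a"
        using h0 s(2) by (intro order_tendstoD(2)[of _ 0]) auto
      then show ?thesis
      proof eventually_elim
        case (elim n)
        then show ?case using s(1) h(1)[of n] by (intro c_id) auto
      qed
    qed
    have "(\<lambda>n. s - h n) \<longlonglongrightarrow> s"
      using tendsto_diff[OF tendsto_const h0, of s] by simp
    then have "(\<lambda>n. c (s - h n)) \<longlonglongrightarrow> s"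
      by (rule Lim_transform_eventually) (use ev in eventually_elim, simp)
    moreover have "\<forall>\<^sub>F n in sequentially. c (s - h n) \<in> {a..b} \<and> c (s - h n) \<noteq> s"
      using ev
    proof eventually_elim
      case (elim n)
      then show ?case using c[of "s - h n"] h(1)[of n] by auto
    qed
    ultimately have "filterlim (\<lambda>n. c (s - h n)) (at s within {a..b}) sequentially"
      by (auto simp: filterlim_at)
    from filterlim_compose[OF 1 this]
    have "(\<lambda>n. (1 / (c (s - h n) - s)) *\<^sub>R (Y (c (s - h n)) - Y s)) \<longlonglongrightarrow> v s" .
    moreover have "\<forall>\<^sub>F n in sequentially. (1 / (c (s - h n) - s)) *\<^sub>R (Y (c (s - h n)) - Y s) = q n s"
      using ev
    proof eventually_elim
      case (elim n)
      then show ?case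
        by (simp add: q_def c_id[OF s(1)] divide_inverse scaleR_diff_right)
    qed
    ultimately have "(\<lambda>n. q n s) \<longlonglongrightarrow> v s"
      by (rule Lim_transform_eventually)
    then have "(\<lambda>n. p s \<bullet> q n s + \<bar>C\<bar> * h n) \<longlonglongrightarrow> p s \<bullet> v s + \<bar>C\<bar> * 0"
      by (intro tendsto_intros h0)
    then show ?case unfolding w_def by simp
  qed
  show "integrable ?M (\<lambda>s. p s \<bullet> v s)"
    by (rule integrable_dominated_convergence[OF pvm wm const conv bound])
  have lim1: "(\<lambda>n. integral\<^sup>L ?M (w n)) \<longlonglongrightarrow> integral\<^sup>L ?M (\<lambda>s. p s \<bullet> v s)"
    by (rule integral_dominated_convergence[OF pvm wm const conv bound])
  have wi: "integrable ?M (w n)" for n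
    by (rule integrable_dominated_convergence2[OF pvm wm const conv bound])
  define d where "d n s = real (Suc n) * (\<Phi> (c s) - \<Phi> (c (s - h n)))" for n s
  have di: "integrable ?M (d n)" for n
    unfolding d_def using \<Phi>c[of _ 0] \<Phi>c[of _ "h n"]
    by (intro continuous_imp_integrable_real continuous_intros) auto
  have "integral {a..b} (d n) = integral\<^sup>L ?M (d n)" for n
    using di by (simp add: lebesgue_integral_eq_integral)
  moreover have "(\<lambda>n. integral {a..b} (d n)) \<longlonglongrightarrow> \<Phi> (c b) - \<Phi> (c a)"
    unfolding d_def h_def using \<Phi>c[of UNIV 0] ab
    by (intro backward_difference_quotient_integral) auto
  ultimately have lim2: "(\<lambda>n. integral\<^sup>L ?M (d n)) \<longlonglongrightarrow> \<Phi> b - \<Phi> a"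
    using ab by (simp add: c_id)
  have le: "integral\<^sup>L ?M (d n) \<le> integral\<^sup>L ?M (w n)" for n
  proof (rule integral_mono_AE[OF di wi])
    show "AE s in ?M. d n s \<le> w n s"
      using sub AE_space
    proof eventually_elim
      case (elim s)
      then have s: "s \<in> {a..b}" by simp
      let ?s = "c (s - h n)"
      \<comment> \<open>The subgradient inequality at \<open>s\<close> is tested at the earlier
        point: a backward quotient bounds the increment of \<open>\<Phi>\<close> from above.\<close>
      have "\<Phi> s - \<Phi> ?s \<le> p s \<bullet> (Y s - Y ?s) + C * (?s - s)\<^sup>2"
        using bspec[OF elim(1) c[of "s - h n"]] by (simp add: inner_diff_right algebra_simps)
      also have "C * (?s - s)\<^sup>2 \<le> \<bar>C\<bar> * (h n)\<^sup>2"
        using c_dist[of "s - h n" s] h(1)[of n] c_id[OF s]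
        by (intro mult_mono) (auto simp: abs_le_square_iff[symmetric])
      finally have "inverse (h n) * (\<Phi> s - \<Phi> ?s) \<le> inverse (h n) * (p s \<bullet> (Y s - Y ?s) + \<bar>C\<bar> * (h n)\<^sup>2)"
        using h(1)[of n] by (intro mult_left_mono) auto
      moreover have "d n s = inverse (h n) * (\<Phi> s - \<Phi> ?s)"
        by (simp only: d_def h(3) c_id[OF s])
      moreover have "w n s = inverse (h n) * (p s \<bullet> (Y s - Y ?s) + \<bar>C\<bar> * (h n)\<^sup>2)"
        using h(1)[of n] by (simp add: w_def q_def c_id[OF s] distrib_left power2_eq_square)
      ultimately show ?case by simp
    qed
  qed
  show "\<Phi> b - \<Phi> a \<le> integral\<^sup>L ?M (\<lambda>s. p s \<bullet> v s)"
    by (rule LIMSEQ_le[OF lim2 lim1]) (simp add: le)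
qed

lemma AE_bounded_of_continuous_Icc:
  fixes g :: "real \<Rightarrow> 'c::euclidean_space"
  assumes "continuous_on {a..b} g"
  obtains K where "AE s in lebesgue_on {a..b}. norm (g s) \<le> K"
proof -
  have "bounded (g ` {a..b})"
    using compact_continuous_image[OF assms] by (simp add: compact_imp_bounded)
  then obtain K where "\<And>s. s \<in> {a..b} \<Longrightarrow> norm (g s) \<le> K"
    unfolding bounded_iff by blast
  then show ?thesis using AE_space by (intro that[of K]) (auto elim: eventually_mono)
qed

text \<open>The curve \<open>y\<close> with velocity \<open>v\<close> descends along the convex functional whose values along \<open>y\<close>,
  relative to its value at \<open>yb\<close>, are \<open>\<phi>\<close>; the point \<open>yb\<close> is only a minimiser up to the error \<open>\<delta>\<close>.\<close>

locale inexact_subgradient_flow =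
  fixes y v :: "real \<Rightarrow> 'b::euclidean_space" and \<phi> :: "real \<Rightarrow> real"
    and yb :: 'b and \<delta> L :: real
  assumes lip: "L-lipschitz_on {0..} y"
    and deriv: "AE s in lebesgue. 0 \<le> s \<longrightarrow> (y has_vector_derivative v s) (at s within {0..})"
    and v_meas: "v \<in> borel_measurable (lebesgue_on {0..})"
    and descent: "\<And>s s'. 0 \<le> s \<Longrightarrow> 0 \<le> s' \<Longrightarrow> \<phi> s - v s \<bullet> (y s' - y s) \<le> \<phi> s'"
    and below: "\<And>s. 0 \<le> s \<Longrightarrow> \<phi> s \<le> - (v s \<bullet> (y s - yb))"
    and above: "\<And>s. 0 \<le> s \<Longrightarrow> - \<delta> * norm (y s - yb) \<le> \<phi> s"
    and \<delta>_nonneg: "0 \<le> \<delta>"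
begin

section \<open>Regularity of the velocity and of the excess\<close>

lemma velocity_bound:
  assumes "0 \<le> s" "(y has_vector_derivative v s) (at s within {0..})"
  shows "norm (v s) \<le> L"
proof -
  have "((\<lambda>z. norm (y z - y s - (z - s) *\<^sub>R v s) / norm (z - s)) \<longlongrightarrow> 0) (at s within {0..})"
    using assms(2) unfolding has_vector_derivative_def has_derivative_iff_norm by blast
  \<comment> \<open>The difference quotient has norm at most \<open>L\<close> and differs from
    \<open>v s\<close> by the remainder, which vanishes as \<open>z\<close> tends to
    \<open>s\<close>.\<close>
  then have "((\<lambda>z. L + norm (y z - y s - (z - s) *\<^sub>R v s) / norm (z - s)) \<longlongrightarrow> L + 0) (at s within {0..})"
    by (intro tendsto_intros)
  moreover have "\<forall>\<^sub>F z in at s within {0..}. norm (v s) \<le> L + norm (y z - y s - (z - s) *\<^sub>R v s) / norm (z - s)"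
    unfolding eventually_at_filter
  proof (intro always_eventually allI impI)
    fix z assume z: "z \<noteq> s" "z \<in> {0..}"
    have "norm ((z - s) *\<^sub>R v s) \<le> norm (y z - y s) + norm (y z - y s - (z - s) *\<^sub>R v s)"
      by (metis norm_minus_commute norm_triangle_sub)
    also have "norm (y z - y s) \<le> L * \<bar>z - s\<bar>"
      using lipschitz_onD[OF lip, of z s] z assms(1) by (simp add: dist_norm)
    finally show "norm (v s) \<le> L + norm (y z - y s - (z - s) *\<^sub>R v s) / norm (z - s)"
      using z(1) by (simp add: divide_simps) (simp add: mult.commute)
  qed
  \<comment> \<open>At \<open>s = 0\<close> only right-sided limits exist, so nontriviality of the
    filter comes from the right.\<close>
  moreover have "at_right s \<le> at s within {0..}"
    by (rule at_le) (use assms(1) in auto)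
  then have "at s within {0..} \<noteq> bot"
    using trivial_limit_at_right_real[of s] by (metis bot_unique)
  ultimately show ?thesis
    using tendsto_lowerbound by fastforce
qed

lemma AE_deriv_Icc:
  assumes "0 \<le> a"
  shows "AE s in lebesgue_on {a..b}. (y has_vector_derivative v s) (at s within {a..b}) \<and> norm (v s) \<le> L"
proof -
  have "AE s in lebesgue. s \<in> {a..b} \<longrightarrow> (y has_vector_derivative v s) (at s within {a..b}) \<and> norm (v s) \<le> L"
    using deriv
  proof eventually_elim
    case (elim s)
    then show ?case
      using assms velocity_bound[of s] has_vector_derivative_within_subset[of y "v s" s "{0..}" "{a..b}"] by auto
  qed
  then show ?thesis by (intro AE_restrict_space_iff[THEN iffD2]) simp
qed

lemma v_meas_Icc: "0 \<le> a \<Longrightarrow> v \<in> borel_measurable (lebesgue_on {a..b})"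
  using v_meas by (rule measurable_restrict_mono) auto

lemma y_continuous: "0 \<le> a \<Longrightarrow> continuous_on {a..b} y"
  using lipschitz_on_continuous_on[OF lip] by (rule continuous_on_subset) auto

text \<open>Where the velocity is at most \<open>L\<close>, \<open>descent\<close> gives the
  one-sided estimate with constant \<open>L * L\<close>. Such times have full measure, so an
  arbitrary \<open>s\<close> is linked to one just after it, at a cost that tends to 0. Swapping the
  two times gives the other side.\<close>

lemma \<phi>_lipschitz: "(L * L)-lipschitz_on {0..} \<phi>"
proof -
  have L0: "0 \<le> L" using lip by (rule lipschitz_on_nonneg)
  have good: "\<phi> s - L * L * \<bar>s' - s\<bar> \<le> \<phi> s'"
    if "0 \<le> s" "0 \<le> s'" "norm (v s) \<le> L" for s s'
  proof -
    have "v s \<bullet> (y s' - y s) \<le> norm (v s) * norm (y s' - y s)" by (rule norm_cauchy_schwarz)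
    also have "\<dots> \<le> L * (L * \<bar>s' - s\<bar>)"
      using that lipschitz_onD[OF lip, of s' s] L0 by (intro mult_mono) (auto simp: dist_norm)
    finally show ?thesis using descent[OF that(1,2)] by simp
  qed
  have le: "\<phi> s - L * L * \<bar>s' - s\<bar> \<le> \<phi> s'" if s: "0 \<le> s" "0 \<le> s'" for s s'
  proof (rule tendsto_le[OF sequentially_bot])
    define h where "h n = inverse (real (Suc n))" for n
    have h0: "h \<longlonglongrightarrow> 0" unfolding h_def by (rule LIMSEQ_inverse_real_of_nat)
    have h: "0 < h n" for n by (simp add: h_def)
    show "(\<lambda>n. \<phi> s') \<longlonglongrightarrow> \<phi> s'" by simp
    have "(\<lambda>n. \<phi> s - L * L * (\<bar>s' - s\<bar> + h n) - norm (v s) * (L * h n))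
        \<longlonglongrightarrow> \<phi> s - L * L * (\<bar>s' - s\<bar> + 0) - norm (v s) * (L * 0)"
      by (intro tendsto_intros h0)
    then show "(\<lambda>n. \<phi> s - L * L * (\<bar>s' - s\<bar> + h n) - norm (v s) * (L * h n))
        \<longlonglongrightarrow> \<phi> s - L * L * \<bar>s' - s\<bar>" by simp
    show "\<forall>\<^sub>F n in sequentially. \<phi> s - L * L * (\<bar>s' - s\<bar> + h n) - norm (v s) * (L * h n) \<le> \<phi> s'"
    proof (intro always_eventually allI)
      fix n
      \<comment> \<open>Otherwise an interval of positive length would be a null set.\<close>
      have "\<exists>z\<in>{s<..<s + h n}. norm (v z) \<le> L"
      proof (rule ccontr)
        assume none: "\<not> ?thesis"
        have "AE z in lebesgue. z \<notin> {s<..<s + h n}"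
          using deriv
        proof eventually_elim
          case (elim z)
          then show ?case using none velocity_bound[of z] s(1) by auto
        qed
        then have "{s<..<s + h n} \<in> null_sets lebesgue"
          by (subst (asm) AE_iff_null_sets[symmetric]) auto
        then show False using h[of n] by (auto simp: null_sets_def)
      qed
      then obtain z where z: "s < z" "z < s + h n" "norm (v z) \<le> L" by auto
      have "v s \<bullet> (y z - y s) \<le> norm (v s) * norm (y z - y s)" by (rule norm_cauchy_schwarz)
      also have "norm (y z - y s) \<le> L * \<bar>z - s\<bar>"
        using lipschitz_onD[OF lip, of z s] s z by (simp add: dist_norm)
      also have "L * \<bar>z - s\<bar> \<le> L * h n" using z L0 by (intro mult_left_mono) auto
      finally have "v s \<bullet> (y z - y s) \<le> norm (v s) * (L * h n)" by (simp add: mult_left_mono)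
      then have 1: "\<phi> s - norm (v s) * (L * h n) \<le> \<phi> z"
        using descent[of s z] s z by simp
      have "L * L * \<bar>s' - z\<bar> \<le> L * L * (\<bar>s' - s\<bar> + h n)"
        using z by (intro mult_left_mono) auto
      moreover have "\<phi> z - L * L * \<bar>s' - z\<bar> \<le> \<phi> s'"
        using good[of z s'] s z by simp
      ultimately show "\<phi> s - L * L * (\<bar>s' - s\<bar> + h n) - norm (v s) * (L * h n) \<le> \<phi> s'"
        using 1 by linarith
    qed
  qed
  show ?thesis
  proof (rule lipschitz_onI)
    fix s s' :: real assume "s \<in> {0..}" "s' \<in> {0..}"
    then show "dist (\<phi> s) (\<phi> s') \<le> L * L * dist s s'"
      using le[of s s'] le[of s' s] by (simp add: dist_real_def abs_le_iff abs_minus_commute)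
  qed simp
qed

lemma \<phi>_continuous: "0 \<le> a \<Longrightarrow> continuous_on {a..b} \<phi>"
  using lipschitz_on_continuous_on[OF \<phi>_lipschitz] by (rule continuous_on_subset) auto

text \<open>The integrated subgradient inequality, set up for the flow. It is applied to the
  distance from \<open>yb\<close>, to half its square and the negative of that, to
  \<open>\<phi>\<close>, and to linear functionals; the constant \<open>C\<close> serves the one
  that is not convex.\<close>

lemma integral_along_y:
  assumes "0 \<le> a" "a < b" "continuous_on {a..b} \<Phi>"
    and "p \<in> borel_measurable (lebesgue_on {a..b})"
    and "AE s in lebesgue_on {a..b}. norm (p s) \<le> K"
    and "\<And>s s'. s \<in> {a..b} \<Longrightarrow> s' \<in> {a..b} \<Longrightarrow>
            \<Phi> s + p s \<bullet> (y s' - y s) - C * (s' - s)\<^sup>2 \<le> \<Phi> s'"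
  shows "integrable (lebesgue_on {a..b}) (\<lambda>s. p s \<bullet> v s)"
    and "\<Phi> b - \<Phi> a \<le> integral\<^sup>L (lebesgue_on {a..b}) (\<lambda>s. p s \<bullet> v s)"
proof -
  have 1: "L-lipschitz_on {a..b} y" using lip by (rule lipschitz_on_subset) (use assms(1) in auto)
  have 2: "AE s in lebesgue_on {a..b}. (y has_vector_derivative v s) (at s within {a..b})"
    using AE_deriv_Icc[OF assms(1)] by eventually_elim simp
  have 3: "AE s in lebesgue_on {a..b}. \<forall>s'\<in>{a..b}.
      \<Phi> s + p s \<bullet> (y s' - y s) - C * (s' - s)\<^sup>2 \<le> \<Phi> s'"
    using AE_space by eventually_elim (use assms(6) in auto)
  note * = subgradient_along_curve_integral[OF assms(2) 1 assms(3) 2 assms(4) v_meas_Icc[OF assms(1)] assms(5) 3]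
  show "integrable (lebesgue_on {a..b}) (\<lambda>s. p s \<bullet> v s)" by (rule *(1))
  show "\<Phi> b - \<Phi> a \<le> integral\<^sup>L (lebesgue_on {a..b}) (\<lambda>s. p s \<bullet> v s)" by (rule *(2))
qed

section \<open>Growth, dissipation and decay along the flow\<close>

lemma inner_velocity_le: "0 \<le> s \<Longrightarrow> (y s - yb) \<bullet> v s \<le> \<delta> * norm (y s - yb)"
  using below[of s] above[of s] by (simp add: inner_commute)

text \<open>The direction \<open>sgn (y s - yb)\<close> is a subgradient of the norm, and its
  product with the velocity is at most \<open>\<delta>\<close>. The norm itself is used because its
  square would need a Gronwall argument. At \<open>y s = yb\<close> the value
  \<open>sgn 0 = 0\<close> is still a subgradient.\<close>

lemma norm_y_le:
  assumes "0 \<le> t"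
  shows "norm (y t - yb) \<le> norm (y 0 - yb) + \<delta> * t"
proof (cases "t = 0")
  case False
  then have t: "0 < t" using assms by simp
  have cont: "continuous_on {0..t} (\<lambda>s. y s - yb)"
    by (intro continuous_intros y_continuous) simp
  have "(\<lambda>s. y s - yb) \<in> borel_measurable (lebesgue_on {0..t})"
    by (rule continuous_imp_measurable_on_sets_lebesgue[OF cont]) simp
  then have m: "(\<lambda>s. sgn (y s - yb)) \<in> borel_measurable (lebesgue_on {0..t})"
    by measurable
  have sub: "norm (y s - yb) + sgn (y s - yb) \<bullet> (y s' - y s) - 0 * (s' - s)\<^sup>2 \<le> norm (y s' - yb)" for s s'
  proof (cases "y s = yb")
    case False
    have "sgn (y s - yb) \<bullet> (y s' - yb) \<le> norm (sgn (y s - yb)) * norm (y s' - yb)"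
      by (rule norm_cauchy_schwarz)
    moreover have "sgn (y s - yb) \<bullet> (y s - yb) = norm (y s - yb)"
      using False by (simp add: sgn_div_norm dot_square_norm power2_eq_square)
    moreover have "y s' - y s = (y s' - yb) - (y s - yb)" by simp
    ultimately show ?thesis using False by (simp only: norm_sgn inner_diff_right) simp
  qed simp
  have bd: "AE s in lebesgue_on {0..t}. norm (sgn (y s - yb)) \<le> 1"
    by (simp add: norm_sgn)
  note * = integral_along_y[where \<Phi> = "\<lambda>s. norm (y s - yb)", OF order_refl t continuous_on_norm[OF cont] m bd sub]
  have int: "integrable (lebesgue_on {0..t}) (\<lambda>s. sgn (y s - yb) \<bullet> v s)" by (rule *(1))
  have "norm (y t - yb) - norm (y 0 - yb) \<le> integral\<^sup>L (lebesgue_on {0..t}) (\<lambda>s. sgn (y s - yb) \<bullet> v s)"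
    by (rule *(2))
  also have "integral\<^sup>L (lebesgue_on {0..t}) (\<lambda>s. sgn (y s - yb) \<bullet> v s) \<le> integral\<^sup>L (lebesgue_on {0..t}) (\<lambda>s. \<delta>)"
  proof (rule integral_mono[OF int])
    show "integrable (lebesgue_on {0..t}) (\<lambda>s. \<delta>)"
      by (intro continuous_imp_integrable_real continuous_intros)
    fix s assume "s \<in> space (lebesgue_on {0..t})"
    then have "(y s - yb) \<bullet> v s \<le> \<delta> * norm (y s - yb)" using inner_velocity_le by simp
    moreover have "sgn (y s - yb) \<bullet> v s = ((y s - yb) \<bullet> v s) / norm (y s - yb)"
      by (simp only: sgn_div_norm inner_scaleR_left divide_inverse mult.commute)
    ultimately show "sgn (y s - yb) \<bullet> v s \<le> \<delta>"
      using \<delta>_nonneg by (cases "y s = yb") (auto simp: divide_le_eq)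
  qed
  also have "integral\<^sup>L (lebesgue_on {0..t}) (\<lambda>s. \<delta>) = \<delta> * t"
    using t by (simp add: measure_restrict_space)
  finally show ?thesis by simp
qed simp

text \<open>Equality comes from two inequalities: half the squared distance is convex, and its
  negative is convex up to the quadratic error \<open>L\<^sup>2 / 2 * (s' - s)\<^sup>2\<close>,
  since \<open>y\<close> is Lipschitz.\<close>

lemma half_norm_sq:
  assumes "0 \<le> a" "a < b"
  shows "integrable (lebesgue_on {a..b}) (\<lambda>s. (y s - yb) \<bullet> v s)"
    and "(norm (y b - yb))\<^sup>2 / 2 - (norm (y a - yb))\<^sup>2 / 2 =
           integral\<^sup>L (lebesgue_on {a..b}) (\<lambda>s. (y s - yb) \<bullet> v s)"
proof -
  have cont: "continuous_on {a..b} (\<lambda>s. y s - yb)"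
    by (intro continuous_intros y_continuous assms)
  have m: "(\<lambda>s. y s - yb) \<in> borel_measurable (lebesgue_on {a..b})"
    by (rule continuous_imp_measurable_on_sets_lebesgue[OF cont]) simp
  then have m': "(\<lambda>s. - (y s - yb)) \<in> borel_measurable (lebesgue_on {a..b})"
    by measurable
  obtain K where K: "AE s in lebesgue_on {a..b}. norm (y s - yb) \<le> K"
    using AE_bounded_of_continuous_Icc[OF cont] by blast
  then have K': "AE s in lebesgue_on {a..b}. norm (- (y s - yb)) \<le> K"
    by (simp only: norm_minus_cancel)
  have exp: "(norm (y s' - yb))\<^sup>2 / 2 = (norm (y s - yb))\<^sup>2 / 2 + (y s - yb) \<bullet> (y s' - y s) + (norm (y s' - y s))\<^sup>2 / 2" for s s'
    unfolding power2_norm_eq_inner by (simp add: inner_diff_left inner_diff_right inner_commute field_simps)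
  have sq: "(norm (y s' - y s))\<^sup>2 \<le> L\<^sup>2 * (s' - s)\<^sup>2" if "s \<in> {a..b}" "s' \<in> {a..b}" for s s'
  proof -
    have "norm (y s' - y s) \<le> L * \<bar>s' - s\<bar>"
      using lipschitz_onD[OF lip, of s' s] that assms by (simp add: dist_norm)
    then have "(norm (y s' - y s))\<^sup>2 \<le> (L * \<bar>s' - s\<bar>)\<^sup>2" by (intro power_mono) auto
    then show ?thesis by (simp add: power_mult_distrib)
  qed
  note up = integral_along_y[where \<Phi> = "\<lambda>s. (norm (y s - yb))\<^sup>2 / 2" and C = 0, OF assms _ m K]
  note dn = integral_along_y[where \<Phi> = "\<lambda>s. - ((norm (y s - yb))\<^sup>2 / 2)" and C = "L\<^sup>2 / 2", OF assms _ m' K']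
  have c: "continuous_on {a..b} (\<lambda>s. (norm (y s - yb))\<^sup>2 / 2)"
    by (intro continuous_intros cont) auto
  have up': "(norm (y s - yb))\<^sup>2 / 2 + (y s - yb) \<bullet> (y s' - y s) - 0 * (s' - s)\<^sup>2 \<le> (norm (y s' - yb))\<^sup>2 / 2" for s s'
    using exp[of s' s] by simp
  have dn': "- ((norm (y s - yb))\<^sup>2 / 2) + - (y s - yb) \<bullet> (y s' - y s) - L\<^sup>2 / 2 * (s' - s)\<^sup>2 \<le> - ((norm (y s' - yb))\<^sup>2 / 2)"
    if "s \<in> {a..b}" "s' \<in> {a..b}" for s s'
    using exp[of s' s] sq[OF that] by (simp only: inner_minus_left)
  show "integrable (lebesgue_on {a..b}) (\<lambda>s. (y s - yb) \<bullet> v s)"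
    by (rule up(1)[OF c up'])
  have "(norm (y b - yb))\<^sup>2 / 2 - (norm (y a - yb))\<^sup>2 / 2 \<le>
           integral\<^sup>L (lebesgue_on {a..b}) (\<lambda>s. (y s - yb) \<bullet> v s)"
    by (rule up(2)[OF c up'])
  moreover have "- ((norm (y b - yb))\<^sup>2 / 2) - - ((norm (y a - yb))\<^sup>2 / 2) \<le>
           integral\<^sup>L (lebesgue_on {a..b}) (\<lambda>s. - (y s - yb) \<bullet> v s)"
    by (rule dn(2)[OF continuous_on_minus[OF c] dn'])
  ultimately show "(norm (y b - yb))\<^sup>2 / 2 - (norm (y a - yb))\<^sup>2 / 2 =
           integral\<^sup>L (lebesgue_on {a..b}) (\<lambda>s. (y s - yb) \<bullet> v s)"
    by (simp only: inner_minus_left integral_minus)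
qed

text \<open>By \<open>descent\<close>, \<open>- v s\<close> acts as a subgradient along the curve,
  so the integrand bounding the increment of \<open>\<phi>\<close> is minus the squared
  speed.\<close>

lemma energy_dissipation:
  assumes "0 \<le> a" "a < b"
  shows "integrable (lebesgue_on {a..b}) (\<lambda>s. v s \<bullet> v s)"
    and "integral\<^sup>L (lebesgue_on {a..b}) (\<lambda>s. v s \<bullet> v s) \<le> \<phi> a - \<phi> b"
proof -
  have vb: "AE s in lebesgue_on {a..b}. norm (- v s) \<le> L"
    using AE_deriv_Icc[OF assms(1)] by eventually_elim simp
  have vm: "(\<lambda>s. - v s) \<in> borel_measurable (lebesgue_on {a..b})"
    using v_meas_Icc[OF assms(1)] by measurable
  have sub: "\<phi> s + - v s \<bullet> (y s' - y s) - 0 * (s' - s)\<^sup>2 \<le> \<phi> s'" if "s \<in> {a..b}" "s' \<in> {a..b}" for s s'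
    using descent[of s s'] that assms(1) by simp
  note * = integral_along_y[OF assms \<phi>_continuous[OF assms(1)] vm vb sub]
  show "integrable (lebesgue_on {a..b}) (\<lambda>s. v s \<bullet> v s)" using *(1) by simp
  show "integral\<^sup>L (lebesgue_on {a..b}) (\<lambda>s. v s \<bullet> v s) \<le> \<phi> a - \<phi> b" using *(2) by simp
qed

lemma v_integrable:
  assumes "0 \<le> a"
  shows "integrable (lebesgue_on {a..b}) v"
proof (rule Bochner_Integration.integrable_bound)
  show "integrable (lebesgue_on {a..b}) (\<lambda>s. L)"
    by (intro continuous_imp_integrable_real continuous_intros)
  show "AE s in lebesgue_on {a..b}. norm (v s) \<le> norm L"
    using AE_deriv_Icc[OF assms(1)] by eventually_elim auto
qed (rule v_meas_Icc[OF assms])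

text \<open>The derivative exists only almost everywhere; the identity is obtained by testing with
  the linear functionals given by \<open>c\<close> and \<open>- c\<close>.\<close>

lemma integral_v:
  assumes "0 \<le> a" "a < b"
  shows "integral\<^sup>L (lebesgue_on {a..b}) v = y b - y a"
proof -
  have le: "c \<bullet> (y b - y a) \<le> c \<bullet> integral\<^sup>L (lebesgue_on {a..b}) v" for c
  proof -
    have "c \<bullet> y b - c \<bullet> y a \<le> integral\<^sup>L (lebesgue_on {a..b}) (\<lambda>s. c \<bullet> v s)"
      by (rule integral_along_y(2)[where K = "norm c" and C = 0, OF assms])
        (auto intro!: continuous_intros y_continuous simp: assms inner_diff_right)
    then show ?thesis using v_integrable[OF assms(1)] by (simp add: inner_diff_right)
  qed
  have "c \<bullet> integral\<^sup>L (lebesgue_on {a..b}) v = c \<bullet> (y b - y a)" for c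
    using le[of c] le[of "- c"] by simp
  then show ?thesis using vector_eq_ldot by blast
qed

lemma \<phi>_antimono: "0 \<le> a \<Longrightarrow> a \<le> b \<Longrightarrow> \<phi> b \<le> \<phi> a"
proof (cases "a = b")
  case False
  assume "0 \<le> a" "a \<le> b"
  with False have ab: "0 \<le> a" "a < b" by auto
  have "0 \<le> integral\<^sup>L (lebesgue_on {a..b}) (\<lambda>s. v s \<bullet> v s)" by (rule integral_nonneg_AE) simp
  then show ?thesis using energy_dissipation(2)[OF ab] by linarith
qed simp

text \<open>Half the squared distance to \<open>yb\<close> changes at rate at most
  \<open>- \<phi> s\<close>, which is at most \<open>- \<phi> t\<close> by monotonicity. Integrate
  over \<open>{0..t}\<close> and drop the final squared distance.\<close>

lemma \<phi>_decay:
  assumes "0 < t"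
  shows "\<phi> t \<le> (norm (y 0 - yb))\<^sup>2 / (2 * t)"
proof -
  have "integral\<^sup>L (lebesgue_on {0..t}) (\<lambda>s. (y s - yb) \<bullet> v s) \<le> integral\<^sup>L (lebesgue_on {0..t}) (\<lambda>s. - \<phi> t)"
  proof (rule integral_mono[OF half_norm_sq(1)[OF _ assms]])
    show "integrable (lebesgue_on {0..t}) (\<lambda>s. - \<phi> t)"
      by (intro continuous_imp_integrable_real continuous_intros)
    fix s assume "s \<in> space (lebesgue_on {0..t})"
    then show "(y s - yb) \<bullet> v s \<le> - \<phi> t"
      using below[of s] \<phi>_antimono[of s t] by (simp add: inner_commute)
  qed simp
  then have "(norm (y t - yb))\<^sup>2 / 2 - (norm (y 0 - yb))\<^sup>2 / 2 \<le> - \<phi> t * t"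
    using half_norm_sq(2)[of 0 t] assms by (simp add: measure_restrict_space mult.commute)
  moreover have "0 \<le> (norm (y t - yb))\<^sup>2" by simp
  ultimately have "\<phi> t * t \<le> (norm (y 0 - yb))\<^sup>2 / 2" by linarith
  then show ?thesis using assms by (simp add: field_simps)
qed

lemma displacement_sq_le:
  assumes "0 \<le> a" "a < b"
  shows "(norm (y b - y a))\<^sup>2 \<le> (b - a) * (\<phi> a - \<phi> b)"
proof -
  define w where "w = y b - y a"
  \<comment> \<open>The mean velocity. Integrating the nonnegative square of \<open>v s - c\<close>
    gives the Cauchy-Schwarz inequality for the displacement.\<close>
  define c where "c = (1 / (b - a)) *\<^sub>R w"
  have vi: "integrable (lebesgue_on {a..b}) (\<lambda>s. c \<bullet> v s)"
    using v_integrable[OF assms(1)] by simp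
  have ci: "integrable (lebesgue_on {a..b}) (\<lambda>s. c \<bullet> c)"
    by (intro continuous_imp_integrable_real continuous_intros)
  have "2 * (c \<bullet> (y b - y a)) - (c \<bullet> c) * (b - a)
      = integral\<^sup>L (lebesgue_on {a..b}) (\<lambda>s. 2 * (c \<bullet> v s) - c \<bullet> c)"
    using vi ci assms v_integrable[OF assms(1)] integral_v[OF assms]
    by (simp add: measure_restrict_space)
  also have "\<dots> \<le> integral\<^sup>L (lebesgue_on {a..b}) (\<lambda>s. v s \<bullet> v s)"
  proof (rule integral_mono[OF _ energy_dissipation(1)[OF assms]])
    show "integrable (lebesgue_on {a..b}) (\<lambda>s. 2 * (c \<bullet> v s) - c \<bullet> c)"
      using vi ci by (intro Bochner_Integration.integrable_diff integrable_mult_right)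
    fix s
    have "0 \<le> (v s - c) \<bullet> (v s - c)" by simp
    then show "2 * (c \<bullet> v s) - c \<bullet> c \<le> v s \<bullet> v s"
      by (simp add: inner_diff_left inner_diff_right inner_commute)
  qed
  also have "\<dots> \<le> \<phi> a - \<phi> b" by (rule energy_dissipation(2)[OF assms])
  finally have "2 * (c \<bullet> (y b - y a)) - (c \<bullet> c) * (b - a) \<le> \<phi> a - \<phi> b" .
  moreover have "c \<bullet> w = (norm w)\<^sup>2 / (b - a)" "(c \<bullet> c) * (b - a) = (norm w)\<^sup>2 / (b - a)"
    using assms by (auto simp: c_def power2_norm_eq_inner)
  ultimately have "(norm w)\<^sup>2 / (b - a) \<le> \<phi> a - \<phi> b" by (simp add: w_def)
  then show ?thesis using assms by (simp add: w_def field_simps)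
qed

end

subsection \<open>Conjugate functions\<close>

lemma closed_epigraph:
  fixes J :: "'a::euclidean_space \<Rightarrow> ereal"
  assumes "lsc_fun J"
  shows "closed {zr :: 'a \<times> real. J (fst zr) \<le> ereal (snd zr)}"
proof -
  have "\<exists>T. open T \<and> zr \<in> T \<and> T \<subseteq> {zr. \<not> J (fst zr) \<le> ereal (snd zr)}"
    if "\<not> J (fst zr) \<le> ereal (snd zr)" for zr :: "'a \<times> real"
  proof -
    obtain z r where zr: "zr = (z, r)" by force
    have "ereal r < J z" using that zr by simp
    from ereal_dense2[OF this] obtain c where c: "ereal r < ereal c" "ereal c < J z" by blast
    have "J z \<le> Liminf (at z) J" using assms by (simp add: lsc_fun_def)
    then have "\<forall>\<^sub>F w in at z. ereal c < J w" using c by (auto simp: le_Liminf_iff)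
    \<comment> \<open>Lower semicontinuity is stated with punctured neighbourhoods;
      \<open>c < J z\<close> supplies the centre.\<close>
    then have "\<forall>\<^sub>F w in nhds z. ereal c < J w"
      using c(2) by (auto simp: eventually_at_filter elim: eventually_mono)
    then obtain S where S: "open S" "z \<in> S" "\<And>w. w \<in> S \<Longrightarrow> ereal c < J w"
      by (auto simp: eventually_nhds)
    have "S \<times> {..<c} \<subseteq> {zr. \<not> J (fst zr) \<le> ereal (snd zr)}"
    proof clarsimp
      fix w s assume "w \<in> S" "s < c" "J w \<le> ereal s"
      then have "ereal c < ereal s" using S(3)[of w] by (blast intro: less_le_trans)
      then show False using \<open>s < c\<close> by simp
    qed
    moreover have "open (S \<times> {..<c})" "zr \<in> S \<times> {..<c}"
      using S c zr by (auto intro: open_Times)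
    ultimately show ?thesis by blast
  qed
  then have "open {zr :: 'a \<times> real. \<not> J (fst zr) \<le> ereal (snd zr)}"
    by (subst open_subopen) blast
  then show ?thesis by (simp add: closed_def Collect_neg_eq[symmetric])
qed

lemma convex_epigraph:
  fixes J :: "'a::euclidean_space \<Rightarrow> ereal"
  assumes "convex_fun J" "proper_fun J"
  shows "convex {zr :: 'a \<times> real. J (fst zr) \<le> ereal (snd zr)}"
proof (rule convexI, clarsimp)
  fix z r w s and u v :: real
  assume *: "J z \<le> ereal r" "J w \<le> ereal s" "0 \<le> u" "0 \<le> v" "u + v = 1"
  have "J (u *\<^sub>R z + v *\<^sub>R w) \<le> ereal u * J z + ereal v * J w"
    using assms(1) * unfolding convex_fun_def
    by (metis add_diff_cancel_right' le_add_same_cancel2)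
  also have "\<dots> \<le> ereal u * ereal r + ereal v * ereal s"
    using * by (intro add_mono ereal_mult_left_mono) auto
  finally show "J (u *\<^sub>R z + v *\<^sub>R w) \<le> ereal (u * r + v * s)" by simp
qed

text \<open>The Fenchel--Moreau theorem. The minorant assumed to exist serves to tilt vertical
  separating hyperplanes.\<close>

lemma le_of_affine_minorants_le:
  fixes J :: "'a::euclidean_space \<Rightarrow> ereal"
  assumes J: "proper_fun J" "convex_fun J" "lsc_fun J"
    and minorant: "\<And>z. ereal (p0 \<bullet> z - k0) \<le> J z"
    and bound: "\<And>q k. (\<And>z. ereal (q \<bullet> z - k) \<le> J z) \<Longrightarrow> q \<bullet> x - k \<le> B"
  shows "J x \<le> ereal B"
proof (rule ccontr)
  assume nle: "\<not> J x \<le> ereal B"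
  define E where "E = {zr :: 'a \<times> real. J (fst zr) \<le> ereal (snd zr)}"
  obtain ab g where sep: "ab \<bullet> (x, B) < g" "\<And>zr. zr \<in> E \<Longrightarrow> g < ab \<bullet> zr"
    using separating_hyperplane_closed_point[of E "(x, B)"] nle
      convex_epigraph[OF J(2,1)] closed_epigraph[OF J(3)] unfolding E_def by auto
  obtain q b where ab: "ab = (q, b)" by force
  have sepx: "q \<bullet> x + b * B < g" using sep(1) by (simp add: ab)
  have sepE: "g < q \<bullet> z + b * r" if "J z \<le> ereal r" for z r
    using sep(2)[of "(z, r)"] that by (simp add: ab E_def)
  obtain z0 r0 where z0: "J z0 = ereal r0"
    using J(1) unfolding proper_fun_def by (metis ereal_cases)
  \<comment> \<open>The epigraph is unbounded upwards, so a hyperplane with \<open>b < 0\<close>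
    could not keep it on one side.\<close>
  have b0: "0 \<le> b"
  proof (rule ccontr)
    assume "\<not> 0 \<le> b"
    then have b: "b < 0" by simp
    define r where "r = max r0 ((g - q \<bullet> z0) / b)"
    have "g < q \<bullet> z0 + b * r" using z0 by (intro sepE) (simp add: r_def)
    moreover have "b * r \<le> b * ((g - q \<bullet> z0) / b)"
      using b by (intro mult_left_mono_neg) (auto simp: r_def)
    ultimately show False using b by simp
  qed
  show False
  proof (cases "b = 0")
    case False
    with b0 have b: "0 < b" by simp
    \<comment> \<open>A nonvertical hyperplane, divided by \<open>b\<close>, is the graph of an
      affine minorant whose value at \<open>x\<close> exceeds \<open>B\<close>.\<close>
    have "ereal ((- (1 / b) *\<^sub>R q) \<bullet> z - (- g / b)) \<le> J z" for z
    proof (cases "J z")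
      case (real r)
      then have "g < q \<bullet> z + b * r" by (intro sepE) simp
      then show ?thesis using b real by (simp add: field_simps)
    qed (use J(1) in \<open>auto simp: proper_fun_def\<close>)
    from bound[OF this] show False using sepx b by (simp add: field_simps)
  next
    case True
    \<comment> \<open>In the vertical case, \<open>l\<close> times the separating functional is
      added to the given minorant; \<open>l\<close> is large enough to lift its value at
      \<open>x\<close> above \<open>B\<close>.\<close>
    define l where "l = (\<bar>B - p0 \<bullet> x + k0\<bar> + 1) / (g - q \<bullet> x)"
    have gx: "0 < g - q \<bullet> x" using sepx True by simp
    have l: "0 \<le> l" "l * (g - q \<bullet> x) = \<bar>B - p0 \<bullet> x + k0\<bar> + 1"
      using gx by (auto simp: l_def)
    have "ereal ((p0 - l *\<^sub>R q) \<bullet> z - (k0 - l * g)) \<le> J z" for z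
    proof (cases "J z")
      case (real r)
      then have "g < q \<bullet> z" using sepE[of z r] True by simp
      then have "l * g \<le> l * (q \<bullet> z)" using l(1) by (intro mult_left_mono) auto
      moreover have "p0 \<bullet> z - k0 \<le> r" using minorant[of z] real by simp
      ultimately show ?thesis using real by (simp add: inner_diff_left)
    qed (use J(1) in \<open>auto simp: proper_fun_def\<close>)
    from bound[OF this] have "p0 \<bullet> x - k0 + l * (g - q \<bullet> x) \<le> B"
      by (simp add: inner_diff_left algebra_simps)
    then show False using l(2) by linarith
  qed
qed

text \<open>Links the conjugate to the affine minorants: real upper bounds of the conjugate at
  \<open>q\<close> are the admissible offsets of minorants with slope \<open>q\<close>.\<close>

lemma fenchel_conj_le_iff:
  assumes "proper_fun J"
  shows "fenchel_conj J q \<le> ereal k \<longleftrightarrow> (\<forall>z. ereal (q \<bullet> z - k) \<le> J z)"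
proof -
  have "ereal (q \<bullet> z) - J z \<le> ereal k \<longleftrightarrow> ereal (q \<bullet> z - k) \<le> J z" for z
    using assms by (cases "J z") (auto simp: proper_fun_def)
  then show ?thesis unfolding fenchel_conj_def by (simp add: SUP_le_iff)
qed

text \<open>The equality case of the Fenchel-Young inequality.\<close>

lemma fenchel_conj_at_subgradient:
  assumes "proper_fun J" "u \<in> subdifferential J x"
  shows "fenchel_conj J u = ereal (u \<bullet> x - real_of_ereal (J x))"
proof -
  from assms(2) obtain j where j: "J x = ereal j"
    by (cases "J x") (auto simp: subdifferential_def)
  have "ereal (u \<bullet> z - (u \<bullet> x - j)) \<le> J z" for z
    using assms(2) j by (auto simp: subdifferential_def inner_diff_right algebra_simps)
  then have "fenchel_conj J u \<le> ereal (u \<bullet> x - j)"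
    using fenchel_conj_le_iff[OF assms(1)] by blast
  moreover have "ereal (u \<bullet> x) - J x \<le> fenchel_conj J u"
    unfolding fenchel_conj_def by (rule SUP_upper) simp
  ultimately show ?thesis using j by auto
qed

subsection \<open>The dual subgradient flow\<close>

theorem mainTheorem2:
  fixes A :: "real ^ 'p \<Rightarrow> real ^ 'd"
    and J :: "real ^ 'p \<Rightarrow> ereal"
    and f f\<delta> ybar :: "real ^ 'd"
    and xbar :: "real ^ 'p"
    and \<delta> tstar :: real
    and x :: "real \<Rightarrow> real ^ 'p"
    and y :: "real \<Rightarrow> real ^ 'd"
  assumes "linear A"
    and "proper_fun J" and "convex_fun J" and "lsc_fun J"
    and "- adjoint A ybar \<in> subdifferential J xbar"
    and "A xbar = f"
    and "\<delta> > 0" and "norm (f\<delta> - f) \<le> \<delta>"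
    and "\<forall>v. subdifferential (\<lambda>w. fenchel_conj J (- adjoint A w)) v
             = (\<lambda>z. - A z) ` subdifferential (fenchel_conj J) (- adjoint A v)"
    and "dual_subgradient_flow J A f\<delta> x y"
    and "y 0 \<noteq> ybar"
    and "tstar = (1 / \<delta>) * norm (y 0 - ybar)"
  shows "bregman J (- adjoint A ybar) (tail_average x tstar) xbar
           \<le> ereal (4 * norm (y 0 - ybar) * \<delta>) \<and>
         norm (A (tail_average x tstar) - f) \<le> sqrt 14 * \<delta>"
proof -
  have adj: "adjoint A w \<bullet> z = w \<bullet> A z" "z \<bullet> adjoint A w = A z \<bullet> w" for w z
    using adjoint_clauses[OF \<open>linear A\<close>] by auto
  define u where "u = - adjoint A ybar"
  obtain j where j: "J xbar = ereal j"
    using assms(5) by (cases "J xbar") (auto simp: subdifferential_def)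
  define v where "v s = A (x s) - f\<delta>" for s
  define H where "H s = real_of_ereal (fenchel_conj J (- adjoint A (y s)))" for s
  obtain L where lip: "L-lipschitz_on {0..} y"
    and sub: "\<And>t. 0 \<le> t \<Longrightarrow> x t \<in> subdifferential (fenchel_conj J) (- adjoint A (y t))"
    and deriv: "AE t in lebesgue. 0 \<le> t \<longrightarrow> (y has_vector_derivative v t) (at t within {0..})"
    and xm: "x \<in> borel_measurable (lebesgue_on {0..})"
    and xi: "\<And>a b. 0 \<le> a \<Longrightarrow> a \<le> b \<Longrightarrow> set_integrable lebesgue {a..b} x"
    using assms(10) unfolding dual_subgradient_flow_def v_def by blast
  have H: "fenchel_conj J (- adjoint A (y s)) = ereal (H s)" if "0 \<le> s" for s
    using sub[OF that] unfolding subdifferential_def H_def by (auto simp: ereal_real)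
  have conj_ybar: "fenchel_conj J u = ereal (u \<bullet> xbar - j)"
    using fenchel_conj_at_subgradient[OF assms(2,5)] j by (simp add: u_def)
  have u_xbar: "u \<bullet> xbar = - (ybar \<bullet> f)"
    using assms(6) by (simp add: u_def adj)
  \<comment> \<open>Used with three choices of \<open>q\<close>: another point of the dual
    trajectory, the slope \<open>u\<close>, and the slope of an arbitrary affine minorant of
    \<open>J\<close>.\<close>
  have subg: "H s + x s \<bullet> (q + adjoint A (y s)) \<le> k" if "0 \<le> s" "fenchel_conj J q \<le> ereal k" for s q k
  proof -
    have "ereal (H s) + ereal (x s \<bullet> (q - - adjoint A (y s))) \<le> fenchel_conj J q"
      using sub[OF that(1)] H[OF that(1)] by (auto simp: subdifferential_def)
    from order_trans[OF this that(2)] show ?thesis by simp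
  qed
  \<comment> \<open>The excess of the dual functional over its value at \<open>ybar\<close>, where
    the conjugate equals \<open>u \<bullet> xbar - j\<close>.\<close>
  define \<phi> where "\<phi> s = H s + f\<delta> \<bullet> (y s - ybar) - (u \<bullet> xbar - j)" for s
  interpret inexact_subgradient_flow y v \<phi> ybar \<delta> L
  proof
    show "v \<in> borel_measurable (lebesgue_on {0..})"
    proof -
      have "A \<in> borel_measurable borel"
        using \<open>linear A\<close> by (intro borel_measurable_continuous_onI linear_continuous_on)
          (simp add: linear_linear)
      from measurable_compose[OF xm this] show ?thesis unfolding v_def by measurable
    qed
    show "\<phi> s - v s \<bullet> (y s' - y s) \<le> \<phi> s'" if "0 \<le> s" "0 \<le> s'" for s s'
    proof -
      have "H s + x s \<bullet> (- adjoint A (y s') + adjoint A (y s)) \<le> H s'"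
        by (rule subg) (use that H in auto)
      then show ?thesis
        by (simp add: \<phi>_def v_def inner_add_right inner_diff_right inner_diff_left adj)
    qed
    show "\<phi> s \<le> - (v s \<bullet> (y s - ybar))" if "0 \<le> s" for s
    proof -
      have "H s + x s \<bullet> (u + adjoint A (y s)) \<le> u \<bullet> xbar - j"
        by (rule subg) (use that conj_ybar in auto)
      then show ?thesis
        by (simp add: \<phi>_def v_def u_def inner_add_right inner_diff_right inner_diff_left adj)
    qed
    show "- \<delta> * norm (y s - ybar) \<le> \<phi> s" if "0 \<le> s" for s
    proof -
      \<comment> \<open>Testing the supremum at \<open>xbar\<close> bounds the excess below by a
        term that is linear in \<open>f\<delta> - f\<close>.\<close>
      have "ereal (- adjoint A (y s) \<bullet> xbar) - J xbar \<le> fenchel_conj J (- adjoint A (y s))"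
        unfolding fenchel_conj_def by (rule SUP_upper) simp
      then have "- (y s \<bullet> f) - j \<le> H s"
        using H[OF that] j assms(6) by (simp add: adj)
      then have "(f\<delta> - f) \<bullet> (y s - ybar) \<le> \<phi> s"
        by (simp add: \<phi>_def u_xbar inner_diff_left inner_diff_right inner_commute)
      moreover have "\<bar>(f\<delta> - f) \<bullet> (y s - ybar)\<bar> \<le> \<delta> * norm (y s - ybar)"
        using Cauchy_Schwarz_ineq2[of "f\<delta> - f" "y s - ybar"] assms(8)
        by (meson mult_right_mono norm_ge_zero order_trans)
      ultimately show ?thesis by linarith
    qed
  qed (use lip deriv assms(7) in auto)
  define r where "r = norm (y 0 - ybar)"
  define t where "t = tstar"
  have r: "0 < r" using assms(11) by (simp add: r_def)
  have t: "0 < t" "t * \<delta> = r" using r assms(7,12) by (auto simp: t_def r_def)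
  let ?M = "lebesgue_on {t/2..t}"
  have xint: "integrable ?M x"
    using xi[of "t/2" t] t by (simp add: set_integrable_def integrable_restrict_space)
  define xh where "xh = tail_average x tstar"
  have xh: "integral\<^sup>L ?M x = (t / 2) *\<^sub>R xh"
    using t by (simp add: xh_def tail_average_def t_def[symmetric] set_lebesgue_integral_def integral_restrict_space)
  have int_inner: "integral\<^sup>L ?M (\<lambda>s. q \<bullet> x s) = (t / 2) * (q \<bullet> xh)" for q
    using xint by (simp add: xh)
  \<comment> \<open>Since \<open>A\<close> commutes with the integral, the averaged residual is the
    displacement of \<open>y\<close> divided by \<open>t / 2\<close>.\<close>
  have Axh: "A xh - f\<delta> = (2 / t) *\<^sub>R (y t - y (t/2))"
  proof -
    have "bounded_linear A" using \<open>linear A\<close> by (simp add: linear_linear)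
    from integral_bounded_linear[OF this xint]
    have "integral\<^sup>L ?M (\<lambda>s. A (x s)) = (t / 2) *\<^sub>R A xh"
      by (simp add: xh linear_cmul[OF \<open>linear A\<close>])
    moreover have "integrable ?M (\<lambda>s. A (x s))"
      using \<open>bounded_linear A\<close> xint by (rule integrable_bounded_linear)
    moreover have "integrable ?M (\<lambda>s. f\<delta>)"
      by (intro continuous_imp_integrable_real continuous_intros)
    ultimately have "integral\<^sup>L ?M v = (t / 2) *\<^sub>R (A xh - f\<delta>)"
      using t unfolding v_def by (simp add: measure_restrict_space scaleR_diff_right)
    moreover have "integral\<^sup>L ?M v = y t - y (t/2)" using t by (intro integral_v) auto
    ultimately show ?thesis using t by simp
  qed
  \<comment> \<open>Here \<open>\<delta> * t = r\<close>, so the distance grows by at most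
    \<open>r / 2\<close> up to \<open>t / 2\<close> and by at most \<open>r\<close> up to
    \<open>t\<close>.\<close>
  have n_half: "norm (y (t/2) - ybar) \<le> 3/2 * r"
    using norm_y_le[of "t/2"] t by (simp add: r_def[symmetric] mult.commute)
  have n_t: "norm (y t - ybar) \<le> 2 * r"
    using norm_y_le[of t] t by (simp add: r_def[symmetric] mult.commute)

  \<comment> \<open>Residual estimate\<close>
  have "norm (A xh - f) \<le> sqrt 14 * \<delta>"
  proof -
    have "\<phi> (t/2) \<le> r\<^sup>2 / t" using \<phi>_decay[of "t/2"] t by (simp add: r_def)
    also have "r\<^sup>2 / t = r * \<delta>" using t by (simp add: power2_eq_square field_simps)
    finally have "\<phi> (t/2) \<le> r * \<delta>" .
    moreover have "- \<delta> * (2 * r) \<le> \<phi> t"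
      using above[of t] n_t t assms(7) mult_left_mono[OF n_t, of \<delta>] by linarith
    ultimately have "\<phi> (t/2) - \<phi> t \<le> 3 * r * \<delta>" by (simp add: algebra_simps)
    then have "(t/2) * (\<phi> (t/2) - \<phi> t) \<le> (t/2) * (3 * r * \<delta>)"
      using t by (intro mult_left_mono) auto
    moreover have "(norm (y t - y (t/2)))\<^sup>2 \<le> (t/2) * (\<phi> (t/2) - \<phi> t)"
      using displacement_sq_le[of "t/2" t] t by simp
    ultimately have "(norm (y t - y (t/2)))\<^sup>2 \<le> 3/2 * (t * \<delta>) * r" by (simp add: algebra_simps)
    also have "\<dots> = 3/2 * t\<^sup>2 * \<delta>\<^sup>2"
      by (simp only: t(2)[symmetric]) (simp add: power2_eq_square)
    finally have "(2 / t)\<^sup>2 * (norm (y t - y (t/2)))\<^sup>2 \<le> (2 / t)\<^sup>2 * (3/2 * t\<^sup>2 * \<delta>\<^sup>2)"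
      by (intro mult_left_mono) auto
    then have "(norm (A xh - f\<delta>))\<^sup>2 \<le> 6 * \<delta>\<^sup>2"
      using t by (simp add: Axh power_mult_distrib power_divide)
    \<comment> \<open>The rational bound 5/2 replaces the root of 6; adding \<open>\<delta>\<close>
      for the data error gives 7/2, whose square 49/4 is below 14.\<close>
    also have "\<dots> \<le> (5/2 * \<delta>)\<^sup>2" by (simp add: power2_eq_square)
    finally have "norm (A xh - f\<delta>) \<le> 5/2 * \<delta>"
      using assms(7) by (simp add: power2_le_iff_abs_le)
    then have "norm (A xh - f) \<le> 7/2 * \<delta>"
      using norm_triangle_ineq[of "A xh - f\<delta>" "f\<delta> - f"] assms(8) by simp
    also have "7/2 \<le> sqrt 14" by (rule real_le_rsqrt) (simp add: power2_eq_square)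
    finally show ?thesis using assms(7) by simp
  qed

  \<comment> \<open>Bregman distance estimate\<close>
  moreover have "bregman J u xh xbar \<le> ereal (4 * r * \<delta>)"
  proof -
    \<comment> \<open>The claim is exactly that \<open>J xh\<close> is at most this number.\<close>
    define B where "B = 4 * r * \<delta> + j + u \<bullet> (xh - xbar)"
    have int_lin: "integrable ?M (\<lambda>s. \<delta> * (r + \<delta> * s))"
      "integral\<^sup>L ?M (\<lambda>s. \<delta> * (r + \<delta> * s)) = 7/8 * r\<^sup>2"
    proof -
      show i: "integrable ?M (\<lambda>s. \<delta> * (r + \<delta> * s))"
        by (intro continuous_imp_integrable_real continuous_intros)
      define F where "F s = \<delta> * r * s + \<delta>\<^sup>2 * s\<^sup>2 / 2" for s
      have "((\<lambda>s. \<delta> * (r + \<delta> * s)) has_integral (F t - F (t/2))) {t/2..t}"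
        unfolding F_def using t
        by (intro fundamental_theorem_of_calculus)
          (auto intro!: derivative_eq_intros simp: has_real_derivative_iff_has_vector_derivative[symmetric] power2_eq_square algebra_simps)
      moreover have "F t - F (t/2) = 7/8 * (t * \<delta>)\<^sup>2"
        by (simp only: F_def t(2)[symmetric]) (simp add: power2_eq_square field_simps)
      ultimately show "integral\<^sup>L ?M (\<lambda>s. \<delta> * (r + \<delta> * s)) = 7/8 * r\<^sup>2"
        using lebesgue_integral_eq_integral[OF i] t(2) by (simp only: integral_unique) simp
    qed
    have "J xh \<le> ereal B"
    proof (rule le_of_affine_minorants_le[OF assms(2-4)])
      show "ereal (u \<bullet> z - (u \<bullet> xbar - j)) \<le> J z" for z
        using fenchel_conj_le_iff[OF assms(2)] conj_ybar by (metis order_refl)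
      fix q k assume "\<And>z. ereal (q \<bullet> z - k) \<le> J z"
      then have qk: "fenchel_conj J q \<le> ereal k" using fenchel_conj_le_iff[OF assms(2)] by blast
      \<comment> \<open>Chosen so that
        \<open>(q - u) \<bullet> xh + c \<le> 4 * r * \<delta>\<close> says that the minorant is at
        most \<open>B\<close> at \<open>xh\<close>.\<close>
      define c where "c = - k + (u \<bullet> xbar - j)"
      have ci: "integrable ?M (\<lambda>s. c)"
        by (intro continuous_imp_integrable_real continuous_intros)
      have qi: "integrable ?M (\<lambda>s. (q - u) \<bullet> x s)" using xint by simp
      have vi: "integrable ?M (\<lambda>s. (y s - ybar) \<bullet> v s)"
        using t by (intro half_norm_sq) auto
      have "(t/2) * ((q - u) \<bullet> xh + c) = integral\<^sup>L ?M (\<lambda>s. (q - u) \<bullet> x s + c)"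
        unfolding Bochner_Integration.integral_add[OF qi ci] int_inner
        using t by (simp add: measure_restrict_space distrib_left)
      also have "\<dots> \<le> integral\<^sup>L ?M (\<lambda>s. \<delta> * (r + \<delta> * s) - (y s - ybar) \<bullet> v s)"
      proof (rule integral_mono)
        fix s assume "s \<in> space ?M"
        then have s: "0 \<le> s" using t by simp
        \<comment> \<open>Split \<open>q + adjoint A (y s)\<close> into \<open>q - u\<close> and
          \<open>adjoint A (y s - ybar)\<close>; the second part pairs with \<open>x s\<close> to
          give the velocity term.\<close>
        have "(q - u) \<bullet> x s + c \<le> - \<phi> s - (y s - ybar) \<bullet> v s"
          using subg[OF s qk]
          by (simp add: c_def \<phi>_def v_def u_def inner_add_right inner_diff_right inner_diff_left adj inner_commute)
        moreover have "- \<phi> s \<le> \<delta> * (r + \<delta> * s)"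
          using above[OF s] mult_left_mono[OF norm_y_le[OF s], of \<delta>] assms(7) unfolding r_def by linarith
        ultimately show "(q - u) \<bullet> x s + c \<le> \<delta> * (r + \<delta> * s) - (y s - ybar) \<bullet> v s" by simp
      qed (use qi ci vi int_lin in auto)
      also have "\<dots> = 7/8 * r\<^sup>2 - ((norm (y t - ybar))\<^sup>2 / 2 - (norm (y (t/2) - ybar))\<^sup>2 / 2)"
        using int_lin vi half_norm_sq(2)[of "t/2" t] t by simp
      \<comment> \<open>The endpoint term at \<open>t / 2\<close> contributes half of 9/4, that is
        9/8, which adds up with 7/8 to 2.\<close>
      also have "\<dots> \<le> 2 * r\<^sup>2"
      proof -
        have "(norm (y (t/2) - ybar))\<^sup>2 \<le> (3/2 * r)\<^sup>2" using n_half by (intro power_mono) auto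
        also have "\<dots> = 9/4 * r\<^sup>2" by (simp add: power2_eq_square)
        finally show ?thesis using zero_le_power2[of "norm (y t - ybar)"] by linarith
      qed
      also have "\<dots> = (t/2) * (4 * r * \<delta>)"
        by (simp only: t(2)[symmetric]) (simp add: power2_eq_square)
      finally have "(q - u) \<bullet> xh + c \<le> 4 * r * \<delta>"
        by (rule mult_left_le_imp_le) (use t in simp)
      then show "q \<bullet> xh - k \<le> B"
        by (simp add: B_def c_def inner_diff_left inner_diff_right)
    qed
    then have "bregman J u xh xbar \<le> ereal B - ereal j - ereal (u \<bullet> (xh - xbar))"
      unfolding bregman_def j by (intro ereal_minus_mono) auto
    then show ?thesis by (simp add: B_def)
  qed
  ultimately show ?thesis by (simp add: xh_def r_def u_def)
qed

end
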